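(* Let $\lambda>0$, $\Delta t>0$, $a\in\mathbb{R}$ and $s=a\Delta t^2$, with $2+(1-a)\lambda\Delta t^2\neq 0$ and $2+a\lambda\Delta t^2\ne 0$. Consider the $\mathbb{P}^1$-DG scheme, i.e. the recursion for $(u_{n,1},u_{n,2})^\top\in\mathbb{R}^2$ $$u_{n,2}=u_{n+1,1},\qquad (2+a\Delta t^2\lambda)\,u_{n,1}+(\lambda\Delta t^2-4)\,u_{n,2}=(a\Delta t^2\lambda-\lambda\Delta t^2-2)\,u_{n+1,2},$$ equivalently $(u_{n+1,1},u_{n+1,2})^\top=G\,(u_{n,1},u_{n,2})^\top$ with $$G=\begin{bmatrix}0&1\\ \frac{2+\lambda s}{\lambda s-\Delta t^2\lambda-2}&\frac{\Delta t^2\lambda-4}{\lambda s-\Delta t^2\lambda-2}\end{bmatrix}.$$ This scheme is a Newmark scheme (applied to $\ddot u=-\lambda u$ with step $\Delta t$) with parameters $\beta=(1-a)/2$ and $\gamma=1-a$. In particular, the DG vector $(u_{n,1},u_{n,2})^\top$ is mapped into the Newmark vector $(u_n,v_n)^\top$ by the matrix $$T=\begin{bmatrix}0&1\\ \frac{-(a+(1-a)/2-1/2)\Delta t^2\lambda-1}{\Delta t}&\frac{(a+(1-a)/2-1)\Delta t^2\lambda+1}{\Delta t}\end{bmatrix},$$ that is, $T(u_{n,1},u_{n,2})^\top=(u_n,v_n)^\top$ where $(u_n,v_n)$ satisfies the Newmark recursion, and the similarity relation $G=T^{-1}G_{\rm New}T$ holds, where $G_{\rm New}$ is the one-step matrix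 of this Newmark scheme.
   Context: The Newmark scheme with parameters $(\beta,\gamma)$ for $\ddot u=f(u)$ is $$u_{n+1}=u_n+\Delta t\,v_n+\Delta t^2\big[(\tfrac12-\beta)f(u_n)+\beta f(u_{n+1})\big],\qquad v_{n+1}=v_n+\Delta t\big[(1-\gamma)f(u_n)+\gamma f(u_{n+1})\big].$$ For $f(u)=-\lambda u$ it can be written as $(u_{n+1},v_{n+1})^\top=G_{\rm New}(u_n,v_n)^\top$, which defines $G_{\rm New}\in\mathbb{R}^{2\times2}$. Origin of the DG scheme: with $t_n=n\Delta t$, $I_n=(t_{n-1},t_n]$, the approximation $u$ of the solution of $\ddot u+\lambda u=0$ is a polynomial of degree $\le1$ on each $I_n$, with $u_{n,1}=u(t_{n-1}^+)$, $u_{n,2}=u(t_n^-)$, such that for all $v\in\mathbb{P}^1(I_{n+1})$: $\int_{I_{n+1}}\ddot u\,\dot v+\lambda\int_{I_{n+1}}u\,\dot v+[\dot u]_n\dot v(t_n^+)+\lambda[u]_nv(t_n^+)-s\lambda\{\dot u\}_n\dot v(t_n^+)=0$, where $[w]_n=w(t_n^+)-w(t_n^-)$ and $\{w\}_n=\frac12(w(t_n^+)+w(t_n^-))$. *)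

theory Defs
  imports "HOL-Analysis.Analysis"
begin

definition newmark_step ::
    "real \<Rightarrow> real \<Rightarrow> real \<Rightarrow> (real \<Rightarrow> real) \<Rightarrow> real \<times> real \<Rightarrow> real \<times> real \<Rightarrow> bool" where
  "newmark_step \<beta> \<gamma> dt f = (\<lambda>(u, v) (u', v').
     u' = u + dt * v + dt\<^sup>2 * ((1/2 - \<beta>) * f u + \<beta> * f u') \<and>
     v' = v + dt * ((1 - \<gamma>) * f u + \<gamma> * f u'))"

definition newmark_scheme ::
    "real \<Rightarrow> real \<Rightarrow> real \<Rightarrow> (real \<Rightarrow> real) \<Rightarrow> (nat \<Rightarrow> real) \<Rightarrow> (nat \<Rightarrow> real) \<Rightarrow> bool" where
  "newmark_scheme \<beta> \<gamma> dt f u v \<longleftrightarrow>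
     (\<forall>n. newmark_step \<beta> \<gamma> dt f (u n, v n) (u (n + 1), v (n + 1)))"

text \<open>
  One-step matrices of the Newmark scheme for the linear force \<open>f u = - lam * u\<close>.
  The scheme is implicit in \<open>u'\<close>, so such a matrix exists only if \<open>1 + \<beta> * lam * dt\<^sup>2 \<noteq> 0\<close>;
  otherwise \<open>newmark_matrix\<close> is an unspecified matrix.
\<close>

definition is_newmark_matrix :: "real \<Rightarrow> real \<Rightarrow> real \<Rightarrow> real \<Rightarrow> real^2^2 \<Rightarrow> bool" where
  "is_newmark_matrix \<beta> \<gamma> dt lam M \<longleftrightarrow>
     (\<forall>u v u' v'. newmark_step \<beta> \<gamma> dt (\<lambda>x. - lam * x) (u, v) (u', v') \<longleftrightarrow>
        (vector [u', v'] :: real^2) = M *v vector [u, v])"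

definition newmark_matrix :: "real \<Rightarrow> real \<Rightarrow> real \<Rightarrow> real \<Rightarrow> real^2^2" where
  "newmark_matrix \<beta> \<gamma> dt lam = (THE M. is_newmark_matrix \<beta> \<gamma> dt lam M)"

text \<open>
  The P1-DG scheme: \<open>u1 n\<close> and \<open>u2 n\<close> are the values at the left and right end of the \<open>n\<close>-th time
  interval.  The recursion is autonomous, so it does not matter that indices start at 0.
\<close>

definition dg_scheme :: "real \<Rightarrow> real \<Rightarrow> real \<Rightarrow> (nat \<Rightarrow> real) \<Rightarrow> (nat \<Rightarrow> real) \<Rightarrow> bool" where
  "dg_scheme a lam dt u1 u2 \<longleftrightarrow>
     (\<forall>n. u2 n = u1 (n + 1) \<and>
          (2 + a * dt\<^sup>2 * lam) * u1 n + (lam * dt\<^sup>2 - 4) * u2 n =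
            (a * dt\<^sup>2 * lam - lam * dt\<^sup>2 - 2) * u2 (n + 1))"

definition dg_matrix :: "real \<Rightarrow> real \<Rightarrow> real \<Rightarrow> real^2^2" where
  "dg_matrix s lam dt = vector
     [vector [0, 1],
      vector [(2 + lam * s) / (lam * s - dt\<^sup>2 * lam - 2),
              (dt\<^sup>2 * lam - 4) / (lam * s - dt\<^sup>2 * lam - 2)]]"

definition dg_to_newmark :: "real \<Rightarrow> real \<Rightarrow> real \<Rightarrow> real^2^2" where
  "dg_to_newmark a lam dt = vector
     [vector [0, 1],
      vector [(- (a + (1 - a) / 2 - 1 / 2) * dt\<^sup>2 * lam - 1) / dt,
              ((a + (1 - a) / 2 - 1) * dt\<^sup>2 * lam + 1) / dt]]"

end

theory Submission
  imports Defs
begin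

text \<open>
  Put \<open>L = lam * dt\<^sup>2\<close> and let \<open>(p, q)\<close> and \<open>(p', q')\<close> be consecutive DG vectors with images
  \<open>(u, v)\<close> and \<open>(u', v')\<close> under the change of variables \<open>T\<close>, so that \<open>u = q\<close>, \<open>u' = q'\<close> and
  \<open>dt * v = - (1 + a * L / 2) * p + (1 - (1 - a) * L / 2) * q\<close>.
  Substituting this into the Newmark update of \<open>u\<close> and doubling gives exactly the three-term
  DG equation.  Once that equation holds, the Newmark update of \<open>v\<close> collapses to
  \<open>(2 + a * L) * (p' - q) = 0\<close>, the continuity equation \<open>p' = q\<close>, because \<open>2 + a * L \<noteq> 0\<close>.
  Thus one DG step is the same as one Newmark step in the variables \<open>T (p, q)\<close>; this is
  \<open>newmark_step_dg_to_newmark\<close>.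

  The matrix statement follows without computing the Newmark matrix.  A DG step is
  multiplication by \<open>G\<close> and \<open>T\<close> is bijective, its determinant being \<open>(1 + a * L / 2) / dt\<close>, so a
  Newmark step is multiplication by \<open>T ** G ** matrix_inv T\<close>
  (\<open>is_newmark_matrix_conjugate\<close>).  A linear map is determined by its graph, hence
  this is the only Newmark matrix, and conjugating back gives the similarity relation.
\<close>

definition dg_step :: "real \<Rightarrow> real \<Rightarrow> real \<Rightarrow> real \<times> real \<Rightarrow> real \<times> real \<Rightarrow> bool" where
  "dg_step a lam dt = (\<lambda>(p, q) (p', q'). q = p' \<and>
     (2 + a * dt\<^sup>2 * lam) * p + (lam * dt\<^sup>2 - 4) * q = (a * dt\<^sup>2 * lam - lam * dt\<^sup>2 - 2) * q')"

lemma dg_scheme_iff_dg_step: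
  "dg_scheme a lam dt u1 u2 \<longleftrightarrow> (\<forall>n. dg_step a lam dt (u1 n, u2 n) (u1 (n + 1), u2 (n + 1)))"
  by (simp add: dg_scheme_def dg_step_def)

lemma vector_2_eq_iff:
  "(vector [x, y] :: real^2) = vector [x', y'] \<longleftrightarrow> x = x' \<and> y = y'"
  by (auto simp: vec_eq_iff forall_2)

lemma matrix_2_mult_vector:
  "(vector [vector [c, d], vector [e, f]] :: real^2^2) *v vector [x, y] =
     vector [c * x + d * y, e * x + f * y]"
  by (simp add: vec_eq_iff forall_2 matrix_vector_mult_def sum_2)

lemma vector_2_eta: "vector [x $ 1, x $ 2] = (x :: real^2)"
  by (simp add: vec_eq_iff forall_2)

text \<open>The denominator of \<open>G\<close> is \<open>- (2 + (1 - a) * lam * dt\<^sup>2)\<close>, whence the hypothesis.\<close>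

lemma dg_step_iff_dg_matrix:
  assumes "2 + (1 - a) * lam * dt\<^sup>2 \<noteq> 0"
  shows "dg_step a lam dt (p, q) (p', q') \<longleftrightarrow>
    vector [p', q'] = dg_matrix (a * dt\<^sup>2) lam dt *v vector [p, q]"
proof -
  define D where "D = lam * (a * dt\<^sup>2) - dt\<^sup>2 * lam - 2"
  have D: "D \<noteq> 0" using assms by (simp add: D_def algebra_simps)
  have "q' = (2 + lam * (a * dt\<^sup>2)) / D * p + (dt\<^sup>2 * lam - 4) / D * q \<longleftrightarrow>
      (2 + lam * (a * dt\<^sup>2)) * p + (dt\<^sup>2 * lam - 4) * q = D * q'"
    using D by (simp add: nonzero_eq_divide_eq add_divide_distrib[symmetric] eq_commute mult.commute)
  then show ?thesis
    by (auto simp: dg_step_def dg_matrix_def matrix_2_mult_vector vector_2_eq_iff D_def mult.commute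
        mult.left_commute)
qed

lemma dg_to_newmark_mult_vector:
  assumes "dt > 0"
  shows "dg_to_newmark a lam dt *v vector [p, q] = vector [u, v] \<longleftrightarrow> u = q \<and>
    dt * v = - (1 + a * lam * dt\<^sup>2 / 2) * p + (1 - (1 - a) * lam * dt\<^sup>2 / 2) * q"
proof -
  define c where "c = - (1 + a * lam * dt\<^sup>2 / 2)"
  define d where "d = 1 - (1 - a) * lam * dt\<^sup>2 / 2"
  have "- (a + (1 - a) / 2 - 1 / 2) * dt\<^sup>2 * lam - 1 = c"
    and "(a + (1 - a) / 2 - 1) * dt\<^sup>2 * lam + 1 = d"
    by (simp_all add: c_def d_def field_simps)
  then have "dg_to_newmark a lam dt = vector [vector [0, 1], vector [c / dt, d / dt]]"
    unfolding dg_to_newmark_def by (simp only:)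
  moreover have "v = c / dt * p + d / dt * q \<longleftrightarrow> dt * v = c * p + d * q"
    using assms by (auto simp: nonzero_eq_divide_eq add_divide_distrib[symmetric] mult.commute)
  ultimately show ?thesis
    by (auto simp: matrix_2_mult_vector vector_2_eq_iff c_def d_def)
qed

text \<open>
  The Newmark residual of \<open>u\<close> is half the residual of the three-term DG equation, and \<open>dt\<close> times
  the Newmark residual of \<open>v\<close> is that same half residual minus
  \<open>(2 + a * lam * dt\<^sup>2) / 2 * (p' - q)\<close>.  This triangular, invertible relation between the two
  pairs of residuals makes them vanish together.
\<close>

lemma newmark_step_dg_to_newmark:
  assumes "dt > 0" and "2 + a * lam * dt\<^sup>2 \<noteq> 0"
    and T: "dg_to_newmark a lam dt *v vector [p, q] = vector [u, v]"
    and T': "dg_to_newmark a lam dt *v vector [p', q'] = vector [u', v']"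
  shows "newmark_step ((1 - a) / 2) (1 - a) dt (\<lambda>x. - lam * x) (u, v) (u', v') \<longleftrightarrow>
    dg_step a lam dt (p, q) (p', q')"
proof -
  note coords = dg_to_newmark_mult_vector[OF \<open>dt > 0\<close>]
  have u: "u = q" "u' = q'"
    and v: "dt * v = - (1 + a * lam * dt\<^sup>2 / 2) * p + (1 - (1 - a) * lam * dt\<^sup>2 / 2) * q"
    and v': "dt * v' = - (1 + a * lam * dt\<^sup>2 / 2) * p' + (1 - (1 - a) * lam * dt\<^sup>2 / 2) * q'"
    using T T' by (simp_all only: coords)
  define ru where
    "ru = u' - (u + dt * v + dt\<^sup>2 * ((1/2 - (1 - a) / 2) * (- lam * u) + (1 - a) / 2 * (- lam * u')))"
  define rv where
    "rv = v' - (v + dt * ((1 - (1 - a)) * (- lam * u) + (1 - a) * (- lam * u')))"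
  define rd where "rd = (2 + a * dt\<^sup>2 * lam) * p + (lam * dt\<^sup>2 - 4) * q
    - (a * dt\<^sup>2 * lam - lam * dt\<^sup>2 - 2) * q'"
  have ru: "2 * ru = rd"
    unfolding ru_def rd_def v u by (simp add: field_simps)
  have "2 * (dt * rv) = 2 * (dt * v') - 2 * (dt * v)
      + 2 * lam * dt\<^sup>2 * (a * u + (1 - a) * u')"
    unfolding rv_def by (simp add: algebra_simps power2_eq_square)
  then have rv: "2 * (dt * rv) = rd - (2 + a * lam * dt\<^sup>2) * (p' - q)"
    unfolding rd_def v v' u by (simp add: field_simps)
  have "ru = 0 \<and> rv = 0 \<longleftrightarrow> rd = 0 \<and> p' = q"
  proof
    assume z: "ru = 0 \<and> rv = 0"
    then have "rd = 0" using ru by simp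
    moreover from this have "(2 + a * lam * dt\<^sup>2) * (p' - q) = 0" using rv z by simp
    ultimately show "rd = 0 \<and> p' = q" using assms(2) by simp
  next
    assume "rd = 0 \<and> p' = q"
    then show "ru = 0 \<and> rv = 0" using ru rv \<open>dt > 0\<close> by simp
  qed
  then show ?thesis
    by (auto simp: newmark_step_def dg_step_def ru_def rv_def rd_def)
qed

lemma invertible_dg_to_newmark:
  assumes "dt > 0" and "2 + a * lam * dt\<^sup>2 \<noteq> 0"
  shows "invertible (dg_to_newmark a lam dt)"
proof -
  have "det (dg_to_newmark a lam dt) = (2 + a * lam * dt\<^sup>2) / (2 * dt)"
    using assms(1) by (simp add: dg_to_newmark_def det_2 field_simps)
  then show ?thesis
    using assms by (simp add: invertible_det_nz)
qed

lemma matrix_inv_mult: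
  fixes A :: "'a::semiring_1^'n^'m"
  assumes "invertible A"
  shows "A ** matrix_inv A = mat 1" and "matrix_inv A ** A = mat 1"
  using someI_ex[OF assms[unfolded invertible_def]] by (simp_all add: matrix_inv_def)

text \<open>
  Since \<open>T\<close> is onto, every pair of Newmark states comes from DG states, so the equivalence of
  single steps describes the Newmark relation on the whole plane; since \<open>T\<close> is one-to-one, the
  equation \<open>y = G *v x\<close> may be read off after applying \<open>T\<close>.  In particular the implicit Newmark
  equations are solvable because the DG equations are.
\<close>

lemma is_newmark_matrix_conjugate:
  assumes "dt > 0" and "2 + (1 - a) * lam * dt\<^sup>2 \<noteq> 0" and "2 + a * lam * dt\<^sup>2 \<noteq> 0"
  defines "T \<equiv> dg_to_newmark a lam dt"
  shows "is_newmark_matrix ((1 - a) / 2) (1 - a) dt lam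
    (T ** dg_matrix (a * dt\<^sup>2) lam dt ** matrix_inv T)"
  unfolding is_newmark_matrix_def
proof (intro allI)
  fix u v u' v' :: real
  have inv: "invertible T"
    unfolding T_def using assms by (intro invertible_dg_to_newmark)
  define x where "x = matrix_inv T *v vector [u, v]"
  define y where "y = matrix_inv T *v vector [u', v']"
  have Tx: "T *v x = vector [u, v]" and Ty: "T *v y = vector [u', v']"
    using inv by (simp_all add: x_def y_def matrix_vector_mul_assoc matrix_inv_mult)
  have "newmark_step ((1 - a) / 2) (1 - a) dt (\<lambda>x. - lam * x) (u, v) (u', v') \<longleftrightarrow>
      dg_step a lam dt (x $ 1, x $ 2) (y $ 1, y $ 2)"
    using assms Tx Ty by (intro newmark_step_dg_to_newmark) (simp_all add: vector_2_eta)
  also have "\<dots> \<longleftrightarrow> y = dg_matrix (a * dt\<^sup>2) lam dt *v x"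
    using dg_step_iff_dg_matrix[OF assms(2), of "x $ 1" "x $ 2" "y $ 1" "y $ 2"]
    by (simp add: vector_2_eta)
  also have "\<dots> \<longleftrightarrow> T *v y = T *v (dg_matrix (a * dt\<^sup>2) lam dt *v x)"
    using inj_matrix_vector_mult[OF inv] by (auto dest: injD)
  finally show "newmark_step ((1 - a) / 2) (1 - a) dt (\<lambda>x. - lam * x) (u, v) (u', v') \<longleftrightarrow>
      vector [u', v'] = T ** dg_matrix (a * dt\<^sup>2) lam dt ** matrix_inv T *v vector [u, v]"
    unfolding Ty by (simp add: x_def matrix_vector_mul_assoc matrix_mul_assoc)
qed

lemma is_newmark_matrix_unique:
  assumes "is_newmark_matrix \<beta> \<gamma> dt lam M" and "is_newmark_matrix \<beta> \<gamma> dt lam N"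
  shows "M = N"
proof -
  have "M *v x = N *v x" for x
    using assms unfolding is_newmark_matrix_def by (metis vector_2_eta)
  then show ?thesis
    by (simp add: matrix_eq)
qed

theorem theorem1:
  fixes lam dt a s \<beta> \<gamma> :: real and G T :: "real^2^2"
  assumes "lam > 0" and "dt > 0" and "s = a * dt\<^sup>2"
    and "2 + (1 - a) * lam * dt\<^sup>2 \<noteq> 0" and "2 + a * lam * dt\<^sup>2 \<noteq> 0"
    and "\<beta> = (1 - a) / 2" and "\<gamma> = 1 - a"
    and "G = dg_matrix s lam dt" and "T = dg_to_newmark a lam dt"
  shows "(\<forall>u1 u2. dg_scheme a lam dt u1 u2 \<longleftrightarrow>
            (\<forall>n. (vector [u1 (n + 1), u2 (n + 1)] :: real^2) = G *v vector [u1 n, u2 n]))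
       \<and> (\<forall>u1 u2 u v. (\<forall>n. T *v vector [u1 n, u2 n] = vector [u n, v n]) \<longrightarrow>
            (dg_scheme a lam dt u1 u2 \<longleftrightarrow> newmark_scheme \<beta> \<gamma> dt (\<lambda>x. - lam * x) u v))
       \<and> (\<exists>!M. is_newmark_matrix \<beta> \<gamma> dt lam M)
       \<and> invertible T
       \<and> G = matrix_inv T ** newmark_matrix \<beta> \<gamma> dt lam ** T"
proof -
  have dt: "dt > 0" and D: "2 + (1 - a) * lam * dt\<^sup>2 \<noteq> 0" and A: "2 + a * lam * dt\<^sup>2 \<noteq> 0"
    using assms by simp_all
  note params = \<open>\<beta> = (1 - a) / 2\<close> \<open>\<gamma> = 1 - a\<close>
  have G: "G = dg_matrix (a * dt\<^sup>2) lam dt" using assms by simp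
  note T = \<open>T = dg_to_newmark a lam dt\<close>
  have inv: "invertible T"
    unfolding T using dt A by (rule invertible_dg_to_newmark)
  have N: "is_newmark_matrix \<beta> \<gamma> dt lam (T ** G ** matrix_inv T)"
    unfolding params G T using dt D A by (rule is_newmark_matrix_conjugate)
  then have ex1: "\<exists>!M. is_newmark_matrix \<beta> \<gamma> dt lam M"
    using is_newmark_matrix_unique by blast
  have "newmark_matrix \<beta> \<gamma> dt lam = T ** G ** matrix_inv T"
    unfolding newmark_matrix_def using ex1 N by (rule the1_equality)
  then have "matrix_inv T ** newmark_matrix \<beta> \<gamma> dt lam ** T
      = (matrix_inv T ** T) ** G ** (matrix_inv T ** T)"
    by (simp add: matrix_mul_assoc)
  then have similar: "G = matrix_inv T ** newmark_matrix \<beta> \<gamma> dt lam ** T"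
    using inv by (simp add: matrix_inv_mult)
  have "dg_scheme a lam dt u1 u2 \<longleftrightarrow>
      (\<forall>n. (vector [u1 (n + 1), u2 (n + 1)] :: real^2) = G *v vector [u1 n, u2 n])" for u1 u2
    unfolding dg_scheme_iff_dg_step G using dg_step_iff_dg_matrix[OF D] by simp
  moreover have "dg_scheme a lam dt u1 u2 \<longleftrightarrow> newmark_scheme \<beta> \<gamma> dt (\<lambda>x. - lam * x) u v"
    if "\<forall>n. T *v vector [u1 n, u2 n] = vector [u n, v n]" for u1 u2 u v
  proof -
    have "newmark_step \<beta> \<gamma> dt (\<lambda>x. - lam * x) (u n, v n) (u (n + 1), v (n + 1)) \<longleftrightarrow>
        dg_step a lam dt (u1 n, u2 n) (u1 (n + 1), u2 (n + 1))" for n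
      unfolding params using dt A that unfolding T by (intro newmark_step_dg_to_newmark) auto
    then show ?thesis
      by (simp add: dg_scheme_iff_dg_step newmark_scheme_def)
  qed
  ultimately show ?thesis
    using ex1 inv similar by blast
qed

end
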